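(* Let $n\ge6$, let $i,j,k,l$ be four distinct elements of $[n]\setminus\{1,2\}$, and let $\Pi_1|\Pi_2|\Pi_3$ be an ordered partition (blocks may be empty) of $[n]\setminus\{1,2,i,j,k,l\}$. Let $\alpha,\beta,\gamma$ be arbitrary orderings (words using each letter exactly once) of the letters of $\Pi_1,\Pi_2,\Pi_3$ respectively. Then the following quadratic binomials are contained in $\mathcal{I}(T_n)$: (1) if $\Pi_2=\emptyset$: $\quad z_{12\alpha ijkl\gamma}\,z_{12\alpha jlik\gamma}-z_{12\alpha ijlk\gamma}\,z_{12\alpha jkil\gamma}$; (2) if $\beta\neq\emptyset$: $\quad z_{12\alpha ij\beta kl\gamma}\,z_{12\alpha ji\beta lk\gamma}-z_{12\alpha ij\beta lk\gamma}\,z_{12\alpha ji\beta kl\gamma}$.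
   Context: $\Sigma_n$ is the set of permutations $\sigma=\sigma_1\cdots\sigma_n$ of $[n]$ (one-line notation) with $\sigma_1=1$, $\sigma_2=2$, and $\sigma_{n+1}:=\sigma_1$. Subscripts such as $12\alpha ijkl\gamma$ denote the permutation in $\Sigma_n$ whose one-line notation is the concatenation. The toric Parke--Taylor variety $T_n\subseteq\mathbb{P}^{(n-2)!-1}$ (homogeneous coordinates $z_\sigma$, $\sigma\in\Sigma_n$) is the Zariski closure of the image of the monomial map $\mathbb{P}^{\binom n2-1}\dashrightarrow\mathbb{P}^{(n-2)!-1}$, $z_\sigma=\prod_{m=1}^n\frac{1}{p_{\sigma_m\sigma_{m+1}}}$, where the coordinates $p_{ab}$ are indexed by unordered pairs (so $p_{ab}=p_{ba}$ here). $\mathcal{I}(T_n)\subseteq\mathbb{C}[z_\sigma:\sigma\in\Sigma_n]$ is its vanishing ideal. *)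

theory Defs
  imports Complex_Main "HOL-Library.Poly_Mapping" "HOL-Combinatorics.Multiset_Permutations"
begin

section \<open>Polynomials with variables indexed by a set\<close>

text \<open>
  A polynomial is a finitely supported map from monomials to coefficients, a monomial being
  a finitely supported map from variables to exponents; \<open>Poly_Mapping\<close> equips
  this type with the usual (convolution) ring structure.
\<close>

type_synonym 'v cpoly = "('v \<Rightarrow>\<^sub>0 nat) \<Rightarrow>\<^sub>0 complex"

definition var :: "'v \<Rightarrow> 'v cpoly" where
  "var x = Poly_Mapping.single (Poly_Mapping.single x 1) 1"

definition polys_in :: "'v set \<Rightarrow> 'v cpoly set" where
  "polys_in I = {f. \<forall>m\<in>Poly_Mapping.keys f. Poly_Mapping.keys m \<subseteq> I}"

definition peval :: "('v \<Rightarrow> complex) \<Rightarrow> 'v cpoly \<Rightarrow> complex" where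
  "peval v f = (\<Sum>m\<in>Poly_Mapping.keys f. Poly_Mapping.lookup f m *
     (\<Prod>x\<in>Poly_Mapping.keys m. v x ^ Poly_Mapping.lookup m x))"

definition homogeneous :: "'v cpoly \<Rightarrow> bool" where
  "homogeneous f \<longleftrightarrow>
     (\<exists>d. \<forall>m\<in>Poly_Mapping.keys f. (\<Sum>x\<in>Poly_Mapping.keys m. Poly_Mapping.lookup m x) = d)"

section \<open>Projective space with homogeneous coordinates indexed by a set\<close>

text \<open>
  A coordinate vector indexed by \<open>I\<close> is a function on the whole index type that is \<open>0\<close>
  outside \<open>I\<close>. A point is the set of all its coordinate vectors, so \<open>v \<in> P\<close> says
  that \<open>v\<close> is a representative of the point \<open>P\<close>.
\<close>

definition proj_point :: "('v \<Rightarrow> complex) \<Rightarrow> ('v \<Rightarrow> complex) set" where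
  "proj_point v = {\<lambda>x. c * v x | c. c \<noteq> 0}"

definition proj_space :: "'v set \<Rightarrow> ('v \<Rightarrow> complex) set set" where
  "proj_space I = {proj_point v | v. (\<forall>x. x \<notin> I \<longrightarrow> v x = 0) \<and> (\<exists>x\<in>I. v x \<noteq> 0)}"

definition proj_zeros :: "'v set \<Rightarrow> 'v cpoly set \<Rightarrow> ('v \<Rightarrow> complex) set set" where
  "proj_zeros I F = {P \<in> proj_space I. \<forall>f\<in>F. \<forall>v\<in>P. peval v f = 0}"

definition zariski_closed :: "'v set \<Rightarrow> ('v \<Rightarrow> complex) set set \<Rightarrow> bool" where
  "zariski_closed I X \<longleftrightarrow>
     (\<exists>F \<subseteq> polys_in I. (\<forall>f\<in>F. homogeneous f) \<and> X = proj_zeros I F)"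

definition zariski_closure ::
    "'v set \<Rightarrow> ('v \<Rightarrow> complex) set set \<Rightarrow> ('v \<Rightarrow> complex) set set" where
  "zariski_closure I X = \<Inter> {Y. zariski_closed I Y \<and> X \<subseteq> Y}"

text \<open>
  A polynomial vanishes at a point if it vanishes at every representative of it; over an
  infinite field these polynomials form the homogeneous ideal generated by the
  homogeneous polynomials vanishing on \<open>X\<close>.
\<close>

definition vanishing_ideal :: "'v set \<Rightarrow> ('v \<Rightarrow> complex) set set \<Rightarrow> 'v cpoly set" where
  "vanishing_ideal I X = {f \<in> polys_in I. \<forall>P\<in>X. \<forall>v\<in>P. peval v f = 0}"

section \<open>The toric Parke--Taylor variety\<close>

text \<open>
  Permutations in one-line notation are lists, so \<open>\<sigma>\<^sub>m\<close> is \<open>\<sigma> ! (m - 1)\<close>.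
\<close>

definition Sigma_perms :: "nat \<Rightarrow> nat list set" where
  "Sigma_perms n = {\<sigma> \<in> permutations_of_set {1..n}. \<exists>\<tau>. \<sigma> = 1 # 2 # \<tau>}"

definition edge_pairs :: "nat \<Rightarrow> nat set set" where
  "edge_pairs n = {e. e \<subseteq> {1..n} \<and> card e = 2}"

text \<open>
  In the product the index \<open>m\<close> is shifted to start at \<open>0\<close>; reduction modulo \<open>n\<close>
  implements \<open>\<sigma>\<^sub>n\<^sub>+\<^sub>1 = \<sigma>\<^sub>1\<close>.
\<close>

definition pt_coords :: "nat \<Rightarrow> (nat set \<Rightarrow> complex) \<Rightarrow> nat list \<Rightarrow> complex" where
  "pt_coords n p \<sigma> =
     (if \<sigma> \<in> Sigma_perms n then \<Prod>m<n. 1 / p {\<sigma> ! m, \<sigma> ! (Suc m mod n)} else 0)"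

text \<open>
  The rational map is evaluated on the dense torus where all \<open>p\<^sub>a\<^sub>b\<close> are nonzero, i.e.\
  where its defining formula makes sense (division by \<open>0\<close> would give \<open>0\<close> in HOL).
\<close>

definition pt_domain :: "nat \<Rightarrow> (nat set \<Rightarrow> complex) set set" where
  "pt_domain n = {P \<in> proj_space (edge_pairs n). \<forall>p\<in>P. \<forall>e\<in>edge_pairs n. p e \<noteq> 0}"

text \<open>
  All representatives \<open>p\<close> of a point yield the same point of the target (lemma
  \<open>pt_map_proj_point\<close> below), so the union is the common value.
\<close>

definition pt_map :: "nat \<Rightarrow> (nat set \<Rightarrow> complex) set \<Rightarrow> (nat list \<Rightarrow> complex) set" where
  "pt_map n P = (\<Union>p\<in>P. proj_point (pt_coords n p))"

definition toric_PT :: "nat \<Rightarrow> (nat list \<Rightarrow> complex) set set" where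
  "toric_PT n = zariski_closure (Sigma_perms n) (pt_map n ` pt_domain n)"

lemma proj_point_scale:
  assumes "c \<noteq> 0"
  shows "proj_point (\<lambda>x. c * v x) = proj_point v"
proof (intro set_eqI iffI)
  fix w assume "w \<in> proj_point (\<lambda>x. c * v x)"
  then obtain d where "d \<noteq> 0" "w = (\<lambda>x. d * (c * v x))"
    by (auto simp: proj_point_def)
  with assms show "w \<in> proj_point v"
    by (auto simp: proj_point_def mult.assoc intro!: exI[of _ "d * c"])
next
  fix w assume "w \<in> proj_point v"
  then obtain d where "d \<noteq> 0" "w = (\<lambda>x. d * v x)"
    by (auto simp: proj_point_def)
  with assms show "w \<in> proj_point (\<lambda>x. c * v x)"
    by (auto simp: proj_point_def intro!: exI[of _ "d / c"])
qed

lemma pt_coords_scale: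
  "pt_coords n (\<lambda>e. c * p e) = (\<lambda>\<sigma>. (1 / c ^ n) * pt_coords n p \<sigma>)"
  by (rule ext) (simp add: pt_coords_def prod_dividef prod.distrib)

lemma pt_map_proj_point: "pt_map n (proj_point p) = proj_point (pt_coords n p)"
proof -
  have "proj_point (pt_coords n q) = proj_point (pt_coords n p)"
    if q: "q \<in> proj_point p" for q
  proof -
    obtain c where c: "c \<noteq> 0" "q = (\<lambda>e. c * p e)"
      using q by (auto simp: proj_point_def)
    show ?thesis
      unfolding c(2) pt_coords_scale using c(1) by (intro proj_point_scale) simp
  qed
  moreover have "p \<in> proj_point p"
    by (auto simp: proj_point_def intro!: exI[of _ 1])
  ultimately show ?thesis
    unfolding pt_map_def by blast
qed

end

theory Submission
  imports Defs
begin

text \<open>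
  The coordinate \<open>z\<^sub>\<sigma>\<close> of a point in the image of the monomial map is the product of
  \<open>1 / p\<^sub>a\<^sub>b\<close> over the edges \<open>ab\<close> of the closed walk through the letters of \<open>\<sigma>\<close>. Hence a
  binomial \<open>z\<^sub>a z\<^sub>b - z\<^sub>c z\<^sub>d\<close> vanishes on the image as soon as the two closed walks
  \<open>a\<close>, \<open>b\<close> together use the same multiset of edges as \<open>c\<close>, \<open>d\<close> together; being homogeneous,
  it then vanishes on the Zariski closure as well (lemma \<open>binomial_in_vanishing_ideal\<close>).

  In both families the four words agree outside a middle segment, so the edges inside the
  common parts cancel. Let \<open>x\<close> be the letter preceding the segment and \<open>y\<close> the letter
  following it (which is \<open>1\<close> if \<open>\<gamma>\<close> is empty). In the first family both products
  contribute the edges \<open>xi, xj, ij, ik, il, jk, jl, kl, ky, ly\<close>. In the second, with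
  \<open>s\<close> and \<open>t\<close> the first and last letter of \<open>\<beta>\<close>, both contribute
  \<open>xi, xj, is, js, tk, tl, ky, ly\<close>, and twice each of \<open>ij\<close>, \<open>kl\<close> and the edges
  inside \<open>\<beta>\<close>.
\<close>

section \<open>Evaluation of quadratic binomials\<close>

lemma peval_superset:
  assumes "finite A" "Poly_Mapping.keys f \<subseteq> A"
  shows "peval v f = (\<Sum>m\<in>A. Poly_Mapping.lookup f m *
     (\<Prod>x\<in>Poly_Mapping.keys m. v x ^ Poly_Mapping.lookup m x))"
  unfolding peval_def using assms
  by (intro sum.mono_neutral_left) (auto simp: in_keys_iff)

lemma peval_diff: "peval v (f - g) = peval v f - peval v g"
proof -
  let ?A = "Poly_Mapping.keys f \<union> Poly_Mapping.keys g"
  have "Poly_Mapping.keys (f - g) \<subseteq> ?A" by (rule keys_diff)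
  then show ?thesis
    by (simp add: peval_superset[of ?A] lookup_minus left_diff_distrib sum_subtractf)
qed

lemma var_mult_var:
  "var a * var b = Poly_Mapping.single (Poly_Mapping.single a 1 + Poly_Mapping.single b 1) 1"
  by (simp add: var_def mult_single)

lemma keys_single_add_single:
  "Poly_Mapping.keys (Poly_Mapping.single a (1::nat) + Poly_Mapping.single b 1) = {a, b}"
  by (auto simp: in_keys_iff lookup_add lookup_single when_def split: if_splits)

lemma peval_var_mult_var: "peval v (var a * var b) = v a * v b"
proof -
  let ?m = "Poly_Mapping.single a (1::nat) + Poly_Mapping.single b 1"
  have "peval v (var a * var b) = (\<Prod>x\<in>{a, b}. v x ^ Poly_Mapping.lookup ?m x)"
    unfolding var_mult_var peval_def by (simp add: keys_single_add_single del: One_nat_def)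
  also have "\<dots> = v a * v b"
    by (cases "a = b") (simp_all add: lookup_add lookup_single power2_eq_square)
  finally show ?thesis .
qed

lemma peval_binomial:
  "peval v (var a * var b - var c * var d) = v a * v b - v c * v d"
  by (simp add: peval_diff peval_var_mult_var)

lemma keys_binomial:
  assumes "m \<in> Poly_Mapping.keys (var a * var b - var c * var d)"
  shows "m = Poly_Mapping.single a 1 + Poly_Mapping.single b 1 \<or>
    m = Poly_Mapping.single c 1 + Poly_Mapping.single d 1"
proof -
  have "m \<in> Poly_Mapping.keys (var a * var b) \<union> Poly_Mapping.keys (var c * var d)"
    using assms by (rule subsetD[OF keys_diff])
  then show ?thesis
    by (simp only: var_mult_var keys_single one_neq_zero if_False Un_iff singleton_iff)
qed

lemma binomial_in_polys_in:
  assumes "{a, b, c, d} \<subseteq> I"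
  shows "var a * var b - var c * var d \<in> polys_in I"
  unfolding polys_in_def mem_Collect_eq
proof
  fix m assume "m \<in> Poly_Mapping.keys (var a * var b - var c * var d)"
  then have "Poly_Mapping.keys m = {a, b} \<or> Poly_Mapping.keys m = {c, d}"
    using keys_binomial keys_single_add_single by metis
  then show "Poly_Mapping.keys m \<subseteq> I" using assms by blast
qed

lemma homogeneous_binomial: "homogeneous (var a * var b - var c * var d)"
proof -
  have deg: "(\<Sum>x\<in>Poly_Mapping.keys m. Poly_Mapping.lookup m x) = 2"
    if "m = Poly_Mapping.single a 1 + Poly_Mapping.single b 1" for m :: "'a \<Rightarrow>\<^sub>0 nat" and a b
    unfolding that keys_single_add_single
    by (cases "a = b") (simp_all add: lookup_add lookup_single del: One_nat_def)
  show ?thesis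
    unfolding homogeneous_def using keys_binomial deg by metis
qed

section \<open>From the image of the monomial map to its closure\<close>

lemma length_Sigma_perms:
  assumes "\<sigma> \<in> Sigma_perms n"
  shows "length \<sigma> = n"
  using assms length_finite_permutations_of_set[of \<sigma> "{1..n}"] by (simp add: Sigma_perms_def)

lemma pt_coords_nonzero:
  assumes "2 \<le> n" "\<sigma> \<in> Sigma_perms n" "\<forall>e\<in>edge_pairs n. p e \<noteq> 0"
  shows "pt_coords n p \<sigma> \<noteq> 0"
proof -
  have \<sigma>: "set \<sigma> = {1..n}" "distinct \<sigma>"
    using assms(2) by (auto simp: Sigma_perms_def permutations_of_set_def)
  have len: "length \<sigma> = n" using assms(2) by (rule length_Sigma_perms)
  have "p {\<sigma> ! m, \<sigma> ! (Suc m mod n)} \<noteq> 0" if "m < n" for m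
  proof -
    have "m \<noteq> Suc m mod n" "Suc m mod n < n"
      using that assms(1) by (auto simp: mod_Suc)
    then have "\<sigma> ! m \<noteq> \<sigma> ! (Suc m mod n)"
      using that \<sigma>(2) len by (simp_all add: nth_eq_iff_index_eq)
    moreover have "\<sigma> ! m \<in> {1..n}" "\<sigma> ! (Suc m mod n) \<in> {1..n}"
      using that \<open>Suc m mod n < n\<close> len nth_mem[of _ \<sigma>] unfolding \<sigma>(1) by blast+
    ultimately have "{\<sigma> ! m, \<sigma> ! (Suc m mod n)} \<in> edge_pairs n"
      by (auto simp: edge_pairs_def)
    then show ?thesis using assms(3) by blast
  qed
  then show ?thesis using assms(2) by (simp add: pt_coords_def)
qed

text \<open>
  The ideal of the image already determines the ideal of the closure, because the zero set
  of a single homogeneous polynomial is closed.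
\<close>

lemma binomial_in_vanishing_ideal:
  assumes n: "2 \<le> n"
    and mem: "{a, b, c, d} \<subseteq> Sigma_perms n"
    and eq: "\<And>p. pt_coords n p a * pt_coords n p b = pt_coords n p c * pt_coords n p d"
  shows "var a * var b - var c * var d \<in> vanishing_ideal (Sigma_perms n) (toric_PT n)"
proof -
  let ?f = "var a * var b - var c * var d"
  let ?I = "Sigma_perms n"
  let ?Z = "proj_zeros ?I {?f}"
  have f: "?f \<in> polys_in ?I" using mem by (rule binomial_in_polys_in)
  have "pt_map n P \<in> ?Z" if P: "P \<in> pt_domain n" for P
  proof -
    obtain p where p: "P = proj_point p"
      using P by (auto simp: pt_domain_def proj_space_def)
    have "p \<in> P" unfolding p by (auto simp: proj_point_def intro!: exI[of _ 1])
    then have "\<forall>e\<in>edge_pairs n. p e \<noteq> 0" using P by (auto simp: pt_domain_def)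
    then have "pt_coords n p a \<noteq> 0" using n mem pt_coords_nonzero by blast
    moreover have "\<forall>x. x \<notin> ?I \<longrightarrow> pt_coords n p x = 0" by (simp add: pt_coords_def)
    ultimately have "proj_point (pt_coords n p) \<in> proj_space ?I"
      using mem unfolding proj_space_def by blast
    moreover have "peval v ?f = 0" if "v \<in> proj_point (pt_coords n p)" for v
    proof -
      obtain r where "v = (\<lambda>x. r * pt_coords n p x)"
        using \<open>v \<in> _\<close> by (auto simp: proj_point_def)
      then show ?thesis using eq[of p] by (simp add: peval_binomial algebra_simps)
    qed
    ultimately show ?thesis
      unfolding p pt_map_proj_point by (simp add: proj_zeros_def)
  qed
  then have "pt_map n ` pt_domain n \<subseteq> ?Z" by blast
  moreover have "zariski_closed ?I ?Z"
    unfolding zariski_closed_def using f homogeneous_binomial by (intro exI[of _ "{?f}"]) auto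
  ultimately have "toric_PT n \<subseteq> ?Z"
    unfolding toric_PT_def zariski_closure_def by blast
  then have "\<forall>P\<in>toric_PT n. \<forall>v\<in>P. peval v ?f = 0" by (auto simp: proj_zeros_def)
  then show ?thesis using f by (simp add: vanishing_ideal_def)
qed

section \<open>Coordinates as weights of closed walks\<close>

text \<open>
  The weight of the walk visiting the letters of a list in order: the product of the weights
  of its steps, so a list with at most one letter has weight \<open>1\<close>.
\<close>

fun walk :: "('a \<Rightarrow> 'a \<Rightarrow> 'b::comm_monoid_mult) \<Rightarrow> 'a list \<Rightarrow> 'b" where
  "walk w (x # y # xs) = w x y * walk w (y # xs)"
| "walk w xs = 1"

lemma walk_append: "walk w (xs @ y # ys) = walk w (xs @ [y]) * walk w (y # ys)"
proof (induction xs)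
  case Nil
  show ?case by simp
next
  case (Cons x xs)
  then show ?case by (cases xs) (simp_all add: mult.assoc)
qed

lemma walk_conv_prod:
  "walk w (xs @ [y]) = (\<Prod>m<length xs. w (xs ! m) ((xs @ [y]) ! Suc m))"
proof (induction xs)
  case (Cons x xs)
  have "walk w ((x # xs) @ [y]) = w x ((xs @ [y]) ! 0) * walk w (xs @ [y])"
    by (cases xs) simp_all
  then show ?case
    by (simp add: Cons.IH prod.lessThan_Suc_shift del: prod.lessThan_Suc)
qed simp

lemma walk_closed:
  assumes "xs \<noteq> []"
  shows "walk w (xs @ [hd xs]) = (\<Prod>m<length xs. w (xs ! m) (xs ! (Suc m mod length xs)))"
  unfolding walk_conv_prod
proof (rule prod.cong[OF refl])
  fix m assume "m \<in> {..<length xs}"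
  then consider "Suc m < length xs" | "Suc m = length xs" by fastforce
  then have "(xs @ [hd xs]) ! Suc m = xs ! (Suc m mod length xs)"
    using assms by cases (simp_all add: nth_append hd_conv_nth)
  then show "w (xs ! m) ((xs @ [hd xs]) ! Suc m) = w (xs ! m) (xs ! (Suc m mod length xs))"
    by (simp only:)
qed

text \<open>
  The four words of a binomial share the prefix \<open>12\<alpha>\<close> and the suffix \<open>\<gamma>\<close>, which enter
  only through the factor \<open>C\<close> and through the letters \<open>x\<close> and \<open>y\<close> adjacent to the
  varying segment.
\<close>

lemma pt_coords_segment:
  obtains C x y where
    "\<And>\<mu>. [1, 2] @ \<alpha> @ \<mu> @ \<gamma> \<in> Sigma_perms n \<Longrightarrow>
       pt_coords n p ([1, 2] @ \<alpha> @ \<mu> @ \<gamma>) = C * walk (\<lambda>a b. 1 / p {a, b}) (x # \<mu> @ [y])"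
proof -
  let ?w = "\<lambda>a b. 1 / p {a, b}"
  obtain as x where as: "[1, 2] @ \<alpha> = as @ [x]"
    by (cases "[1, 2] @ \<alpha>" rule: rev_cases) simp_all
  obtain y bs where bs: "\<gamma> @ [1] = y # bs"
    by (cases "\<gamma> @ [1]") simp_all
  have "pt_coords n p ([1, 2] @ \<alpha> @ \<mu> @ \<gamma>) =
      (walk ?w (as @ [x]) * walk ?w (y # bs)) * walk ?w (x # \<mu> @ [y])"
    if mem: "[1, 2] @ \<alpha> @ \<mu> @ \<gamma> \<in> Sigma_perms n" for \<mu>
  proof -
    let ?\<sigma> = "[1, 2] @ \<alpha> @ \<mu> @ \<gamma>"
    have "length ?\<sigma> = n" using length_Sigma_perms[OF mem] .
    then have "pt_coords n p ?\<sigma> = walk ?w (?\<sigma> @ [hd ?\<sigma>])"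
      using mem walk_closed[of ?\<sigma> ?w] by (simp only: pt_coords_def if_True) simp
    also have "hd ?\<sigma> = 1" by simp
    also have "?\<sigma> @ [1] = as @ x # \<mu> @ y # bs"
      using as bs by (metis append.assoc append_Cons append_Nil)
    also have "walk ?w \<dots> = walk ?w (as @ [x]) * (walk ?w (x # \<mu> @ [y]) * walk ?w (y # bs))"
      using walk_append[of ?w as x "\<mu> @ y # bs"] walk_append[of ?w "x # \<mu>" y bs] by simp
    finally show ?thesis by (simp only: mult_ac)
  qed
  then show ?thesis by (rule that)
qed

section \<open>The quadratic relations\<close>

lemma pt_coords_relation_adjacent:
  assumes "[1, 2] @ \<alpha> @ [i, j, k, l] @ \<gamma> \<in> Sigma_perms n"
    "[1, 2] @ \<alpha> @ [j, l, i, k] @ \<gamma> \<in> Sigma_perms n"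
    "[1, 2] @ \<alpha> @ [i, j, l, k] @ \<gamma> \<in> Sigma_perms n"
    "[1, 2] @ \<alpha> @ [j, k, i, l] @ \<gamma> \<in> Sigma_perms n"
  shows "pt_coords n p ([1, 2] @ \<alpha> @ [i, j, k, l] @ \<gamma>) *
      pt_coords n p ([1, 2] @ \<alpha> @ [j, l, i, k] @ \<gamma>) =
    pt_coords n p ([1, 2] @ \<alpha> @ [i, j, l, k] @ \<gamma>) *
      pt_coords n p ([1, 2] @ \<alpha> @ [j, k, i, l] @ \<gamma>)"
proof -
  let ?w = "\<lambda>a b. 1 / p {a, b}"
  obtain C x y where *: "\<And>\<mu>. [1, 2] @ \<alpha> @ \<mu> @ \<gamma> \<in> Sigma_perms n \<Longrightarrow>
      pt_coords n p ([1, 2] @ \<alpha> @ \<mu> @ \<gamma>) = C * walk ?w (x # \<mu> @ [y])"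
    using pt_coords_segment by blast
  have weight: "walk ?w (x # [a, b, c, d] @ [y]) = ?w x a * ?w a b * ?w b c * ?w c d * ?w d y"
    for a b c d by (simp add: mult.assoc)
  have sym: "?w k i = ?w i k" "?w l i = ?w i l" "?w l k = ?w k l"
    by (simp_all only: insert_commute)
  show ?thesis
    unfolding *[OF assms(1)] *[OF assms(2)] *[OF assms(3)] *[OF assms(4)] weight sym
    by (simp only: mult_ac)
qed

lemma pt_coords_relation_separated:
  assumes "\<beta> \<noteq> []"
    "[1, 2] @ \<alpha> @ ([i, j] @ \<beta> @ [k, l]) @ \<gamma> \<in> Sigma_perms n"
    "[1, 2] @ \<alpha> @ ([j, i] @ \<beta> @ [l, k]) @ \<gamma> \<in> Sigma_perms n"
    "[1, 2] @ \<alpha> @ ([i, j] @ \<beta> @ [l, k]) @ \<gamma> \<in> Sigma_perms n"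
    "[1, 2] @ \<alpha> @ ([j, i] @ \<beta> @ [k, l]) @ \<gamma> \<in> Sigma_perms n"
  shows "pt_coords n p ([1, 2] @ \<alpha> @ ([i, j] @ \<beta> @ [k, l]) @ \<gamma>) *
      pt_coords n p ([1, 2] @ \<alpha> @ ([j, i] @ \<beta> @ [l, k]) @ \<gamma>) =
    pt_coords n p ([1, 2] @ \<alpha> @ ([i, j] @ \<beta> @ [l, k]) @ \<gamma>) *
      pt_coords n p ([1, 2] @ \<alpha> @ ([j, i] @ \<beta> @ [k, l]) @ \<gamma>)"
proof -
  let ?w = "\<lambda>a b. 1 / p {a, b}"
  obtain C x y where *: "\<And>\<mu>. [1, 2] @ \<alpha> @ \<mu> @ \<gamma> \<in> Sigma_perms n \<Longrightarrow>
      pt_coords n p ([1, 2] @ \<alpha> @ \<mu> @ \<gamma>) = C * walk ?w (x # \<mu> @ [y])"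
    using pt_coords_segment by blast
  \<comment> \<open>A nonempty \<open>\<beta>\<close> makes the factors before and after it independent of each other.\<close>
  obtain bs t where t: "\<beta> = bs @ [t]" using assms(1) by (metis rev_exhaust)
  have split: "walk ?w (x # ([a, b] @ \<beta> @ [c, d]) @ [y]) =
      walk ?w (x # a # b # \<beta>) * walk ?w [t, c, d, y]" for a b c d
    using walk_append[of ?w "x # a # b # bs" t "[c, d, y]"] by (simp add: t)
  show ?thesis
    unfolding *[OF assms(2)] *[OF assms(3)] *[OF assms(4)] *[OF assms(5)] split
    by (simp only: mult_ac)
qed

theorem theorem4p11:
  fixes n i j k l :: nat
    and \<Pi>1 \<Pi>2 \<Pi>3 :: "nat set"
    and \<alpha> \<beta> \<gamma> :: "nat list"
  assumes "n \<ge> 6"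
    and "distinct [i, j, k, l]"
    and "{i, j, k, l} \<subseteq> {1..n} - {1, 2}"
    and "\<Pi>1 \<union> \<Pi>2 \<union> \<Pi>3 = {1..n} - {1, 2, i, j, k, l}"
    and "\<Pi>1 \<inter> \<Pi>2 = {}" and "\<Pi>1 \<inter> \<Pi>3 = {}" and "\<Pi>2 \<inter> \<Pi>3 = {}"
    and "\<alpha> \<in> permutations_of_set \<Pi>1"
    and "\<beta> \<in> permutations_of_set \<Pi>2"
    and "\<gamma> \<in> permutations_of_set \<Pi>3"
  shows
    "(\<Pi>2 = {} \<longrightarrow>
        var ([1, 2] @ \<alpha> @ [i, j, k, l] @ \<gamma>) * var ([1, 2] @ \<alpha> @ [j, l, i, k] @ \<gamma>)
      - var ([1, 2] @ \<alpha> @ [i, j, l, k] @ \<gamma>) * var ([1, 2] @ \<alpha> @ [j, k, i, l] @ \<gamma>)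
      \<in> vanishing_ideal (Sigma_perms n) (toric_PT n)) \<and>
     (\<beta> \<noteq> [] \<longrightarrow>
        var ([1, 2] @ \<alpha> @ [i, j] @ \<beta> @ [k, l] @ \<gamma>) * var ([1, 2] @ \<alpha> @ [j, i] @ \<beta> @ [l, k] @ \<gamma>)
      - var ([1, 2] @ \<alpha> @ [i, j] @ \<beta> @ [l, k] @ \<gamma>) * var ([1, 2] @ \<alpha> @ [j, i] @ \<beta> @ [k, l] @ \<gamma>)
      \<in> vanishing_ideal (Sigma_perms n) (toric_PT n))"
proof (intro conjI impI)
  have n: "2 \<le> n" using assms(1) by simp
  have \<alpha>: "set \<alpha> = \<Pi>1" "distinct \<alpha>" and \<beta>: "set \<beta> = \<Pi>2" "distinct \<beta>"
    and \<gamma>: "set \<gamma> = \<Pi>3" "distinct \<gamma>"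
    using assms(8-10) by (auto simp: permutations_of_set_def)
  have mem: "[1, 2] @ \<alpha> @ \<mu> @ \<gamma> \<in> Sigma_perms n"
    if "distinct \<mu>" "set \<mu> = {i, j, k, l} \<union> \<Pi>2" for \<mu>
  proof -
    let ?A = "{1, 2, i, j, k, l}" and ?B = "\<Pi>1 \<union> \<Pi>2 \<union> \<Pi>3"
    have "?A \<subseteq> {1..n}" using n assms(3) by simp
    then have "?A \<union> ?B = {1..n}" unfolding assms(4) by blast
    moreover have "set ([1, 2] @ \<alpha> @ \<mu> @ \<gamma>) = ?A \<union> ?B"
      using that(2) \<alpha>(1) \<gamma>(1) by auto
    ultimately have set_word: "set ([1, 2] @ \<alpha> @ \<mu> @ \<gamma>) = {1..n}" by (simp only:)
    have AB: "?A \<inter> ?B = {}" unfolding assms(4) by blast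
    have "set \<mu> \<inter> set \<gamma> = {}"
      unfolding that(2) \<gamma>(1) using AB assms(7) by blast
    moreover have "set \<alpha> \<inter> (set \<mu> \<union> set \<gamma>) = {}"
      unfolding that(2) \<alpha>(1) \<gamma>(1) using AB assms(5,6) by blast
    moreover have "set [1, 2] \<inter> (set \<alpha> \<union> (set \<mu> \<union> set \<gamma>)) = {}"
    proof -
      have "{1, 2} \<inter> {i, j, k, l} = {}" using assms(3) by blast
      moreover have "{1, 2} \<inter> ?B = {}" using AB by blast
      ultimately show ?thesis unfolding that(2) \<alpha>(1) \<gamma>(1) list.set by blast
    qed
    moreover have "distinct [1, 2::nat]" by simp
    ultimately have "distinct ([1, 2] @ \<alpha> @ \<mu> @ \<gamma>)"
      using that(1) \<alpha>(2) \<gamma>(2) by (simp only: distinct_append set_append simp_thms)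
    with set_word have "[1, 2] @ \<alpha> @ \<mu> @ \<gamma> \<in> permutations_of_set {1..n}"
      by (rule permutations_of_setI)
    then show ?thesis unfolding Sigma_perms_def by simp
  qed
  {
    assume "\<Pi>2 = {}"
    then have mem4: "[1, 2] @ \<alpha> @ [a, b, c, d] @ \<gamma> \<in> Sigma_perms n"
      if "distinct [a, b, c, d]" "{a, b, c, d} = {i, j, k, l}" for a b c d
      using that by (intro mem) simp_all
    have m: "[1, 2] @ \<alpha> @ [i, j, k, l] @ \<gamma> \<in> Sigma_perms n"
      "[1, 2] @ \<alpha> @ [j, l, i, k] @ \<gamma> \<in> Sigma_perms n"
      "[1, 2] @ \<alpha> @ [i, j, l, k] @ \<gamma> \<in> Sigma_perms n"
      "[1, 2] @ \<alpha> @ [j, k, i, l] @ \<gamma> \<in> Sigma_perms n"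
      by (rule mem4; use assms(2) in auto)+
    show "var ([1, 2] @ \<alpha> @ [i, j, k, l] @ \<gamma>) * var ([1, 2] @ \<alpha> @ [j, l, i, k] @ \<gamma>)
      - var ([1, 2] @ \<alpha> @ [i, j, l, k] @ \<gamma>) * var ([1, 2] @ \<alpha> @ [j, k, i, l] @ \<gamma>)
      \<in> vanishing_ideal (Sigma_perms n) (toric_PT n)"
      using m by (intro binomial_in_vanishing_ideal n pt_coords_relation_adjacent) blast+
  next
    assume "\<beta> \<noteq> []"
    have "{i, j, k, l} \<inter> \<Pi>2 = {}" using assms(4) by blast
    have mem4: "[1, 2] @ \<alpha> @ ([a, b] @ \<beta> @ [c, d]) @ \<gamma> \<in> Sigma_perms n"
      if "distinct [a, b, c, d]" "{a, b, c, d} = {i, j, k, l}" for a b c d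
    proof (rule mem)
      have "set ([a, b] @ \<beta> @ [c, d]) = {a, b, c, d} \<union> \<Pi>2" unfolding \<beta>(1)[symmetric] by auto
      then show "set ([a, b] @ \<beta> @ [c, d]) = {i, j, k, l} \<union> \<Pi>2" unfolding that(2) .
      have "{a, b, c, d} \<inter> set \<beta> = {}"
        unfolding that(2) \<beta>(1) using \<open>{i, j, k, l} \<inter> \<Pi>2 = {}\<close> .
      then show "distinct ([a, b] @ \<beta> @ [c, d])" using that(1) \<beta>(2) by simp
    qed
    have m: "[1, 2] @ \<alpha> @ ([i, j] @ \<beta> @ [k, l]) @ \<gamma> \<in> Sigma_perms n"
      "[1, 2] @ \<alpha> @ ([j, i] @ \<beta> @ [l, k]) @ \<gamma> \<in> Sigma_perms n"
      "[1, 2] @ \<alpha> @ ([i, j] @ \<beta> @ [l, k]) @ \<gamma> \<in> Sigma_perms n"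
      "[1, 2] @ \<alpha> @ ([j, i] @ \<beta> @ [k, l]) @ \<gamma> \<in> Sigma_perms n"
      by (rule mem4; use assms(2) in auto)+
    have "var ([1, 2] @ \<alpha> @ ([i, j] @ \<beta> @ [k, l]) @ \<gamma>) *
        var ([1, 2] @ \<alpha> @ ([j, i] @ \<beta> @ [l, k]) @ \<gamma>)
      - var ([1, 2] @ \<alpha> @ ([i, j] @ \<beta> @ [l, k]) @ \<gamma>) *
        var ([1, 2] @ \<alpha> @ ([j, i] @ \<beta> @ [k, l]) @ \<gamma>)
      \<in> vanishing_ideal (Sigma_perms n) (toric_PT n)"
      using m \<open>\<beta> \<noteq> []\<close>
      by (intro binomial_in_vanishing_ideal n pt_coords_relation_separated) blast+
    then show "var ([1, 2] @ \<alpha> @ [i, j] @ \<beta> @ [k, l] @ \<gamma>) * var ([1, 2] @ \<alpha> @ [j, i] @ \<beta> @ [l, k] @ \<gamma>)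
      - var ([1, 2] @ \<alpha> @ [i, j] @ \<beta> @ [l, k] @ \<gamma>) * var ([1, 2] @ \<alpha> @ [j, i] @ \<beta> @ [k, l] @ \<gamma>)
      \<in> vanishing_ideal (Sigma_perms n) (toric_PT n)"
      by (simp only: append_assoc)
  }
qed

end
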